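(* For $T_{s,\ell}$ (with $\ell\ge 2$), $\lambda=\lambda_{\max}(R_{T_{s,\ell}})$ satisfies $R_\ell(\lambda)=\beta_s(\lambda)$, where $$\beta_s(\lambda):=2\lambda+1+\frac{2}{s+1}-\frac{2s}{(s+1)\bigl((s+1)\lambda+3\bigr)},\qquad R_\ell(\lambda):=\frac{\cosh\left(\frac{\ell-3}{2}t\right)}{\cosh\left(\frac{\ell-1}{2}t\right)},\quad t=\operatorname{arcosh}(1+\lambda).$$ For $s>3$ the equation $R_\ell(\lambda)=\beta_s(\lambda)$ has a unique positive root; for $s=3$ it has the root $\lambda=0$ and no positive root.
   Context: For a finite tree $T=(V,E)$ let $d_z$ denote the degree of the vertex $z$. The Ricci matrix $R_T\in\mathbb R^{E\times E}$ is the real symmetric matrix indexed by edges with entries $(R_T)_{e,e}=-\left(\frac1{d_x}+\frac1{d_y}\right)$ for $e=\{x,y\}$, $(R_T)_{e,e'}=\frac1{d_z}$ if $e\ne e'$ and $e\cap e'=\{z\}$, and $(R_T)_{e,e'}=0$ if $e\cap e'=\varnothing$. $\lambda_{\max}(M)$ denotes the largest eigenvalue of a real symmetric matrix $M$. The symmetric double star $S_{s,s}$ consists of two adjacent centers, each having $s$ leaf neighbours. $T_{s,\ell}$ is obtained from $S_{s,s}$ by subdividing the central edge into a path of length $\ell$ between the two centers; the two centers have degree $s+1$ and the interior vertices of the path have degree $2$. (The scalar function $R_\ell$ is not to be confused with the matrix $R_T$.) *)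

theory Defs
  imports "HOL-Analysis.Analysis"
begin

(* A graph is given by its set of edges, each edge being the set of its two endpoints; a tree
   with at least one edge has no isolated vertices, so nothing is lost. *)

definition degree :: "'v set set \<Rightarrow> 'v \<Rightarrow> nat" where
  "degree E z = card {e \<in> E. z \<in> e}"

(* For e = {x, y} the first sum is 1 / d_x + 1 / d_y. Two distinct edges share at most one vertex
   z, so the second sum is 1 / d_z if they meet in z, and the empty sum 0 if they are disjoint. *)

definition ricci_matrix :: "'v set set \<Rightarrow> 'v set \<Rightarrow> 'v set \<Rightarrow> real" where
  "ricci_matrix E e e' =
     (if e = e' then - (\<Sum>z\<in>e. 1 / real (degree E z))
      else (\<Sum>z\<in>e \<inter> e'. 1 / real (degree E z)))"

(* A square matrix over a finite index set I is a function of two arguments, of which only the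
   values on I matter; likewise for vectors. *)

definition eigenvalue_on :: "'i set \<Rightarrow> ('i \<Rightarrow> 'i \<Rightarrow> real) \<Rightarrow> real \<Rightarrow> bool" where
  "eigenvalue_on I M \<mu> \<longleftrightarrow>
     (\<exists>x :: 'i \<Rightarrow> real. (\<exists>i\<in>I. x i \<noteq> 0) \<and> (\<forall>i\<in>I. (\<Sum>j\<in>I. M i j * x j) = \<mu> * x i))"

definition lambda_max :: "'i set \<Rightarrow> ('i \<Rightarrow> 'i \<Rightarrow> real) \<Rightarrow> real" where
  "lambda_max I M = (GREATEST \<mu>. eigenvalue_on I M \<mu>)"

(* Path i (for i \<le> l) are the vertices of the subdivided central edge. The centers are Path 0 and
   Path l, and Leaf c j (for j < s) is the j-th leaf attached to the center Path c. *)

datatype vertex = Path nat | Leaf nat nat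

definition double_star_subdiv :: "nat \<Rightarrow> nat \<Rightarrow> vertex set set" where
  "double_star_subdiv s l =
     {{Path i, Path (Suc i)} |i. i < l} \<union> {{Path c, Leaf c j} |c j. c \<in> {0, l} \<and> j < s}"

lemma degree_double_star_subdiv_center:
  assumes "l \<ge> 1" and c: "c \<in> {0, l}"
  shows "degree (double_star_subdiv s l) (Path c) = s + 1"
proof -
  let ?p = "if c = 0 then {Path 0, Path 1} else {Path (l - 1), Path l}"
  have "{e \<in> double_star_subdiv s l. Path c \<in> e} = insert ?p ((\<lambda>j. {Path c, Leaf c j}) ` {..<s})"
  proof (cases "c = 0")
    case True
    then show ?thesis using assms by (auto simp: double_star_subdiv_def)
  next
    case False
    have "l = Suc (l - 1)" using assms by simp
    then show ?thesis using assms False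
      by (auto simp: double_star_subdiv_def intro: exI[of _ "l - 1"])
  qed
  moreover have "inj_on (\<lambda>j. {Path c, Leaf c j}) {..<s}"
    by (auto simp: inj_on_def doubleton_eq_iff)
  moreover have "?p \<notin> (\<lambda>j. {Path c, Leaf c j}) ` {..<s}"
    by (auto simp: doubleton_eq_iff)
  ultimately show ?thesis
    by (simp add: degree_def card_image)
qed

lemma degree_double_star_subdiv_interior:
  assumes "0 < i" "i < l"
  shows "degree (double_star_subdiv s l) (Path i) = 2"
proof -
  have "{e \<in> double_star_subdiv s l. Path i \<in> e} = {{Path (i - 1), Path i}, {Path i, Path (Suc i)}}"
    using assms by (auto simp: double_star_subdiv_def intro: exI[of _ "i - 1"])
  moreover have "{Path (i - 1), Path i} \<noteq> {Path i, Path (Suc i)}"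
    using assms by (auto simp: doubleton_eq_iff)
  ultimately show ?thesis
    by (simp add: degree_def)
qed

lemma degree_double_star_subdiv_leaf:
  assumes "c \<in> {0, l}" "j < s"
  shows "degree (double_star_subdiv s l) (Leaf c j) = 1"
proof -
  have "{e \<in> double_star_subdiv s l. Leaf c j \<in> e} = {{Path c, Leaf c j}}"
    using assms by (auto simp: double_star_subdiv_def)
  then show ?thesis
    by (simp add: degree_def)
qed

definition beta_fun :: "nat \<Rightarrow> real \<Rightarrow> real" where
  "beta_fun s \<mu> =
     2 * \<mu> + 1 + 2 / (real s + 1) - 2 * real s / ((real s + 1) * ((real s + 1) * \<mu> + 3))"

(* Evaluated in the complex numbers: for s < 3 the largest eigenvalue is negative, and then
   t = arcosh (1 + \<mu>) is purely imaginary (the real arcosh is not meaningful below 1). For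
   \<mu> \<ge> 0 this is the real expression, see R_fun_nonneg. *)

definition R_fun :: "nat \<Rightarrow> real \<Rightarrow> complex" where
  "R_fun l \<mu> =
     (let t = arcosh (1 + complex_of_real \<mu>)
      in cosh ((of_nat l - 3) / 2 * t) / cosh ((of_nat l - 1) / 2 * t))"

lemma cosh_complex_of_real: "cosh (complex_of_real x) = complex_of_real (cosh x)"
  by (simp add: cosh_field_def exp_of_real flip: of_real_minus)

lemma arcosh_complex_of_real:
  assumes "x \<ge> 1"
  shows "arcosh (complex_of_real x) = complex_of_real (arcosh x)"
proof -
  have "x\<^sup>2 - 1 \<ge> 0"
    using assms by (simp add: one_le_power)
  then have "((complex_of_real x)\<^sup>2 - 1) powr of_real (1 / 2) = of_real ((x\<^sup>2 - 1) powr (1 / 2))"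
    using powr_of_real[of "x\<^sup>2 - 1" "1 / 2"] by simp
  moreover have "x + (x\<^sup>2 - 1) powr (1 / 2) > 0"
    using assms by (intro add_pos_nonneg) auto
  ultimately show ?thesis
    unfolding arcosh_def by (metis Ln_of_real of_real_add of_real_eq_id id_apply)
qed

lemma R_fun_nonneg:
  assumes "\<mu> \<ge> 0"
  shows "R_fun l \<mu> = complex_of_real
     (cosh ((real l - 3) / 2 * arcosh (1 + \<mu>)) / cosh ((real l - 1) / 2 * arcosh (1 + \<mu>)))"
proof -
  have "arcosh (1 + complex_of_real \<mu>) = complex_of_real (arcosh (1 + \<mu>))"
    using arcosh_complex_of_real[of "1 + \<mu>"] assms by simp
  then show ?thesis
    by (simp add: R_fun_def Let_def flip: cosh_complex_of_real)
qed

end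

theory Submission
  imports Defs
begin

text \<open>
  A positive eigenvector of a matrix with nonnegative off-diagonal entries belongs to the largest
  eigenvalue. For a function w with w(x-1) + w(x+1) = 2 (1 + \<mu>) w(x), even and positive on the
  path, put the value w at the distance of a path edge from the middle of the path and a suitable
  constant on the leaf edges. This is an eigenvector of the Ricci matrix for \<mu> exactly if the
  equation at the centers holds, which is the scalar equation for \<mu>. The function w is a cosh
  for \<mu> \<ge> 0 and a cosine for \<mu> < 0. A root is found by the intermediate value theorem.
  Uniqueness needs no monotonicity: every nonnegative root equals the largest eigenvalue.
\<close>

section \<open>Positive eigenvectors and the largest eigenvalue\<close>

text \<open>An eigenvector \<open>x\<close> for \<open>\<nu>\<close> is compared with
  \<open>v\<close> at an index where \<open>\<bar>x i\<bar> / v i\<close> is largest. That row of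
  the eigenvector equation, bounded termwise by the same row for \<open>k * v\<close>, gives
  \<open>\<nu> \<le> \<mu>\<close>.\<close>

lemma lambda_max_eqI:
  assumes "finite I" and "I \<noteq> {}"
    and nonneg: "\<And>i j. i \<in> I \<Longrightarrow> j \<in> I \<Longrightarrow> i \<noteq> j \<Longrightarrow> M i j \<ge> 0"
    and pos: "\<And>i. i \<in> I \<Longrightarrow> v i > 0"
    and eig: "\<And>i. i \<in> I \<Longrightarrow> (\<Sum>j\<in>I. M i j * v j) = \<mu> * v i"
  shows "lambda_max I M = \<mu>"
  unfolding lambda_max_def
proof (rule Greatest_equality)
  show "eigenvalue_on I M \<mu>"
    unfolding eigenvalue_on_def using assms by (intro exI[of _ v]) (auto simp: less_imp_neq[symmetric])
next
  fix \<nu> assume "eigenvalue_on I M \<nu>"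
  then obtain x i0 where i0: "i0 \<in> I" "x i0 \<noteq> 0"
    and x: "\<And>i. i \<in> I \<Longrightarrow> (\<Sum>j\<in>I. M i j * x j) = \<nu> * x i"
    unfolding eigenvalue_on_def by blast
  define k where "k = Max ((\<lambda>i. \<bar>x i\<bar> / v i) ` I)"
  have k_ge: "\<bar>x j\<bar> \<le> k * v j" if "j \<in> I" for j
  proof -
    have "\<bar>x j\<bar> / v j \<le> k"
      unfolding k_def using assms(1) that by (intro Max_ge) auto
    then show ?thesis using pos[OF that] by (simp add: pos_divide_le_eq)
  qed
  have "k \<in> (\<lambda>i. \<bar>x i\<bar> / v i) ` I"
    unfolding k_def using assms(1,2) by (intro Max_in) auto
  then obtain i where i: "i \<in> I" and k: "k = \<bar>x i\<bar> / v i" by blast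
  have xi: "\<bar>x i\<bar> = k * v i" using k pos[OF i] by simp
  have "0 < k * v i0" using k_ge[OF i0(1)] i0(2) by linarith
  then have "k > 0" using pos[OF i0(1)] by (simp add: zero_less_mult_iff)
  \<comment> \<open>The factor \<open>sgn (x i)\<close> normalizes \<open>x\<close> to be
    nonnegative at \<open>i\<close>, where it then equals \<open>k * v i\<close>. Thus the diagonal
    terms agree exactly and a negative diagonal entry does no harm.\<close>
  have "\<nu> * (k * v i) = (\<Sum>j\<in>I. M i j * x j) * sgn (x i)"
    using x[OF i] xi by (simp add: abs_sgn mult.assoc)
  also have "\<dots> = (\<Sum>j\<in>I. M i j * (x j * sgn (x i)))"
    by (simp add: sum_distrib_right mult.assoc)
  also have "\<dots> \<le> (\<Sum>j\<in>I. M i j * (k * v j))"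
  proof (rule sum_mono)
    fix j assume j: "j \<in> I"
    show "M i j * (x j * sgn (x i)) \<le> M i j * (k * v j)"
    proof (cases "j = i")
      case True
      then show ?thesis using xi by (simp add: abs_sgn)
    next
      case False
      have "x j * sgn (x i) \<le> \<bar>x j\<bar>" by (auto simp: sgn_real_def)
      then show ?thesis
        using k_ge[OF j] nonneg[OF i j] False by (intro mult_left_mono) auto
    qed
  qed
  also have "\<dots> = k * (\<Sum>j\<in>I. M i j * v j)"
    by (simp add: sum_distrib_left algebra_simps)
  also have "\<dots> = \<mu> * (k * v i)" using eig[OF i] by simp
  finally show "\<nu> \<le> \<mu>" using \<open>k > 0\<close> pos[OF i] by simp
qed

section \<open>The Ricci matrix as a sum over vertices\<close>

text \<open>Off the diagonal the entries are those of a weighted edge incidence product; on the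
  diagonal the sign is flipped, which costs \<open>2 * x e\<close> at each end. Each row then needs
  only the vertex sums of \<open>x\<close> at the ends of the edge.\<close>

lemma ricci_matrix_mult_vec:
  assumes "finite E" "e \<in> E" "finite e"
  shows "(\<Sum>e'\<in>E. ricci_matrix E e e' * x e') =
    (\<Sum>z\<in>e. ((\<Sum>e'\<in>{e'\<in>E. z \<in> e'}. x e') - 2 * x e) / real (degree E z))"
proof -
  define r where "r z = 1 / real (degree E z)" for z
  have "(\<Sum>e'\<in>E. ricci_matrix E e e' * x e') =
      (\<Sum>e'\<in>E. (\<Sum>z\<in>e \<inter> e'. r z) * x e') - 2 * (\<Sum>z\<in>e. r z) * x e"
  proof -
    have "(\<Sum>e'\<in>E. ricci_matrix E e e' * x e') =
        (\<Sum>e'\<in>E. (\<Sum>z\<in>e \<inter> e'. r z) * x e' - (if e' = e then 2 * (\<Sum>z\<in>e. r z) * x e else 0))"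
      by (intro sum.cong) (auto simp: ricci_matrix_def r_def)
    then show ?thesis using assms by (simp add: sum_subtractf sum.delta)
  qed
  also have "(\<Sum>e'\<in>E. (\<Sum>z\<in>e \<inter> e'. r z) * x e') = (\<Sum>e'\<in>E. \<Sum>z\<in>e. if z \<in> e' then r z * x e' else 0)"
    using assms(3) by (intro sum.cong refl) (simp add: sum.inter_restrict sum_distrib_right if_distrib[of "\<lambda>u. u * _"] cong: if_cong)
  also have "\<dots> = (\<Sum>z\<in>e. \<Sum>e'\<in>E. if z \<in> e' then r z * x e' else 0)"
    by (rule sum.swap)
  also have "\<dots> = (\<Sum>z\<in>e. r z * (\<Sum>e'\<in>{e'\<in>E. z \<in> e'}. x e'))"
    using assms(1) by (auto simp: sum.inter_filter sum_distrib_left intro!: sum.cong)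
  finally have "(\<Sum>e'\<in>E. ricci_matrix E e e' * x e') =
      (\<Sum>z\<in>e. r z * (\<Sum>e'\<in>{e'\<in>E. z \<in> e'}. x e')) - 2 * (\<Sum>z\<in>e. r z) * x e" .
  moreover have "(\<Sum>z\<in>e. r z * T z) - 2 * (\<Sum>z\<in>e. r z) * c = (\<Sum>z\<in>e. (T z - 2 * c) / real (degree E z))" for T c
    by (simp add: r_def sum_subtractf diff_divide_distrib sum_distrib_left sum_distrib_right)
  ultimately show ?thesis by simp
qed

section \<open>Edges of the subdivided double star\<close>

lemma finite_double_star_subdiv: "finite (double_star_subdiv s l)"
proof -
  have "double_star_subdiv s l = (\<lambda>i. {Path i, Path (Suc i)}) ` {..<l} \<union>
      (\<lambda>(c, j). {Path c, Leaf c j}) ` ({0, l} \<times> {..<s})"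
    by (auto simp: double_star_subdiv_def)
  then show ?thesis by simp
qed

lemma double_star_subdiv_incident_center:
  assumes "l \<ge> 1" and "c \<in> {0, l}"
  shows "{e \<in> double_star_subdiv s l. Path c \<in> e} =
    insert (if c = 0 then {Path 0, Path 1} else {Path (l - 1), Path l}) ((\<lambda>j. {Path c, Leaf c j}) ` {..<s})"
proof (cases "c = 0")
  case True
  then show ?thesis using assms by (auto simp: double_star_subdiv_def)
next
  case False
  have "l = Suc (l - 1)" using assms by simp
  then show ?thesis using assms False
    by (auto simp: double_star_subdiv_def intro: exI[of _ "l - 1"])
qed

lemma double_star_subdiv_incident_interior:
  assumes "0 < i" "i < l"
  shows "{e \<in> double_star_subdiv s l. Path i \<in> e} = {{Path (i - 1), Path i}, {Path i, Path (Suc i)}}"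
  using assms by (auto simp: double_star_subdiv_def intro: exI[of _ "i - 1"])

lemma double_star_subdiv_incident_leaf:
  assumes "c \<in> {0, l}" "j < s"
  shows "{e \<in> double_star_subdiv s l. Leaf c j \<in> e} = {{Path c, Leaf c j}}"
  using assms by (auto simp: double_star_subdiv_def)

section \<open>The symmetric eigenvector\<close>

fun path_pos :: "vertex \<Rightarrow> real" where
  "path_pos (Path i) = real i"
| "path_pos (Leaf c j) = 0"

text \<open>The mean position of the two ends of the path edge from i to i + 1, minus l / 2, is
  i - (l - 1) / 2, the signed distance of this edge from the middle of the path.\<close>

definition mid_edge_fun :: "nat \<Rightarrow> (real \<Rightarrow> real) \<Rightarrow> real \<Rightarrow> vertex set \<Rightarrow> real" where
  "mid_edge_fun l w a e =
     (if \<exists>c j. Leaf c j \<in> e then a else w ((\<Sum>z\<in>e. path_pos z) / 2 - real l / 2))"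

lemma mid_edge_fun_leaf: "mid_edge_fun l w a {Path c, Leaf c j} = a"
  by (auto simp: mid_edge_fun_def)

lemma mid_edge_fun_path:
  "mid_edge_fun l w a {Path i, Path (Suc i)} = w (real i - (real l - 1) / 2)"
proof -
  have "(real i + (1 + real i)) / 2 - real l / 2 = real i - (real l - 1) / 2"
    by (simp add: field_simps)
  then show ?thesis by (simp add: mid_edge_fun_def)
qed

text \<open>The leaf rows fix the leaf value \<open>a\<close>. With this value, \<open>root\<close>
  says that each center acts on its path edge like a vertex of degree 2 followed by one more path
  edge, so every path row becomes an instance of \<open>rec\<close>. Keeping \<open>w\<close>
  abstract serves both the cosh and the cosine.\<close>

lemma lambda_max_double_star_subdivI:
  fixes w :: "real \<Rightarrow> real"
  assumes l: "l \<ge> 2"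
    and even: "\<And>x. w (- x) = w x"
    and rec: "\<And>x. w (x - 1) + w (x + 1) = 2 * (1 + \<mu>) * w x"
    and pos: "\<And>x. \<bar>x\<bar> \<le> (real l - 1) / 2 \<Longrightarrow> w x > 0"
    and D: "(real s + 1) * \<mu> + 3 > 0"
    and root: "w ((real l - 3) / 2) = beta_fun s \<mu> * w ((real l - 1) / 2)"
  shows "lambda_max (double_star_subdiv s l) (ricci_matrix (double_star_subdiv s l)) = \<mu>"
proof -
  define E where "E = double_star_subdiv s l"
  define m where "m = (real l - 1) / 2"
  define d where "d = (real s + 1) * \<mu> + 3"
  \<comment> \<open>Solves the leaf row
    \<open>(w m + s * a - 2 * a) / (s + 1) - a = \<mu> * a\<close> for \<open>a\<close>.\<close>
  define a where "a = w m / d"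
  define x where "x = mid_edge_fun l w a"
  define S where "S z = (\<Sum>e\<in>{e\<in>E. z \<in> e}. x e)" for z
  have "w m > 0" using pos[of m] l by (simp add: m_def)
  have "d > 0" using D by (simp add: d_def)
  have "a > 0" using \<open>w m > 0\<close> \<open>d > 0\<close> by (simp add: a_def)
  have wm: "w m = d * a" using \<open>d > 0\<close> by (simp add: a_def)
  have x_path: "x {Path i, Path (Suc i)} = w (real i - m)" for i
    by (simp add: x_def m_def mid_edge_fun_path)
  have x_leaf: "x {Path c, Leaf c j} = a" for c j
    by (simp add: x_def mid_edge_fun_leaf)
  \<comment> \<open>The left side is the contribution of a center to the row of its path edge. The
    right side is that of a degree 2 vertex with a fictitious edge at offset
    \<open>m + 1\<close>.\<close>
  have boundary: "(real s * a - w m) / (real s + 1) = (w (m + 1) - w m) / 2"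
  proof -
    have "w (m - 1) = beta_fun s \<mu> * w m"
      using root by (simp add: m_def diff_divide_distrib)
    then have "w (m + 1) - w m = (2 * (1 + \<mu>) - beta_fun s \<mu> - 1) * w m"
      using rec[of m] by (simp add: algebra_simps)
    also have "\<dots> = (2 * real s / ((real s + 1) * d) - 2 / (real s + 1)) * w m"
      by (simp add: beta_fun_def d_def)
    also have "\<dots> = 2 * ((real s * a - w m) / (real s + 1))"
      by (simp add: a_def left_diff_distrib right_diff_distrib diff_divide_distrib mult_ac)
    finally show ?thesis
      by (simp only: nonzero_mult_div_cancel_left[OF zero_neq_numeral[symmetric]])
  qed
  have S_center: "S (Path c) = w m + real s * a" if c: "c \<in> {0, l}" for c
  proof -
    have "(\<Sum>e\<in>(\<lambda>j. {Path c, Leaf c j}) ` {..<s}. x e) = real s * a"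
      by (subst sum.reindex) (auto simp: inj_on_def doubleton_eq_iff x_leaf)
    moreover have "(if c = 0 then {Path 0, Path 1} else {Path (l - 1), Path l})
        \<notin> (\<lambda>j. {Path c, Leaf c j}) ` {..<s}"
      by (auto simp: doubleton_eq_iff)
    \<comment> \<open>The first and last path edges have offsets \<open>- m\<close> and
      \<open>m\<close>, so evenness gives them the same value.\<close>
    moreover have "x (if c = 0 then {Path 0, Path 1} else {Path (l - 1), Path l}) = w m"
      using x_path[of 0] x_path[of "l - 1"] l even[of m]
      by (auto simp: m_def of_nat_diff field_simps)
    ultimately show ?thesis
      unfolding S_def E_def using l c by (subst double_star_subdiv_incident_center) auto
  qed
  have S_interior: "S (Path i) = w (real i - 1 - m) + w (real i - m)" if i: "0 < i" "i < l" for i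
  proof -
    have "{Path (i - 1), Path i} \<noteq> {Path i, Path (Suc i)}"
      using i by (auto simp: doubleton_eq_iff)
    then show ?thesis
      unfolding S_def E_def double_star_subdiv_incident_interior[OF i]
      using x_path[of "i - 1"] x_path[of i] i by (simp add: of_nat_diff)
  qed
  have S_leaf: "S (Leaf c j) = a" if "c \<in> {0, l}" "j < s" for c j
    unfolding S_def E_def double_star_subdiv_incident_leaf[OF that] by (simp add: x_leaf)
  have deg_center: "degree E (Path c) = s + 1" if "c \<in> {0, l}" for c
    using degree_double_star_subdiv_center[of l c s] l that by (simp add: E_def)
  have deg_interior: "degree E (Path i) = 2" if "0 < i" "i < l" for i
    using degree_double_star_subdiv_interior[OF that] by (simp add: E_def)
  have deg_leaf: "degree E (Leaf c j) = 1" if "c \<in> {0, l}" "j < s" for c j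
    using degree_double_star_subdiv_leaf[OF that] by (simp add: E_def)
  have E_cases: "(\<exists>i<l. e = {Path i, Path (Suc i)}) \<or> (\<exists>c j. c \<in> {0, l} \<and> j < s \<and> e = {Path c, Leaf c j})"
    if "e \<in> E" for e
    using that unfolding E_def double_star_subdiv_def by blast
  have "w (real i - m) > 0" if "i < l" for i
  proof -
    have "real i + 1 \<le> real l" using that by linarith
    then show ?thesis by (intro pos) (auto simp: m_def abs_le_iff field_simps)
  qed
  then have x_pos: "x e > 0" if "e \<in> E" for e
    using E_cases[OF that] \<open>a > 0\<close> by (auto simp: x_path x_leaf)
  have eig: "(\<Sum>e'\<in>E. ricci_matrix E e e' * x e') = \<mu> * x e" if e: "e \<in> E" for e
  proof -
    have "finite e" using E_cases[OF e] by auto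
    then have row: "(\<Sum>e'\<in>E. ricci_matrix E e e' * x e') = (\<Sum>z\<in>e. (S z - 2 * x e) / real (degree E z))"
      using ricci_matrix_mult_vec[of E e x] e finite_double_star_subdiv by (simp add: E_def S_def)
    from E_cases[OF e] show ?thesis
    proof (elim disjE exE conjE)
      fix i assume i: "i < l" and e_eq: "e = {Path i, Path (Suc i)}"
      \<comment> \<open>For \<open>i = 0\<close> the edge has offset \<open>- m\<close>; evenness
        moves \<open>boundary\<close> to the fictitious edge at \<open>- m - 1\<close>.\<close>
      have left: "(S (Path i) - 2 * x e) / real (degree E (Path i)) = (w (real i - m - 1) - w (real i - m)) / 2"
      proof (cases "i = 0")
        case True
        then show ?thesis
          using boundary even[of m] even[of "- m - 1"]
          by (simp add: S_center deg_center e_eq x_path[of 0, simplified] algebra_simps)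
      next
        case False
        then show ?thesis
          using i by (simp add: S_interior deg_interior e_eq x_path algebra_simps)
      qed
      have right: "(S (Path (Suc i)) - 2 * x e) / real (degree E (Path (Suc i))) = (w (real i - m + 1) - w (real i - m)) / 2"
      proof (cases "Suc i = l")
        case True
        then have "real i - m = m" by (auto simp: m_def field_simps)
        then show ?thesis
          using boundary True S_center[of l] deg_center[of l] x_path[of i]
          by (simp add: e_eq algebra_simps)
      next
        case False
        then show ?thesis
          using i S_interior[of "Suc i"] deg_interior[of "Suc i"]
          by (simp add: e_eq x_path algebra_simps)
      qed
      have "(\<Sum>z\<in>e. (S z - 2 * x e) / real (degree E z)) =
          (w (real i - m - 1) - w (real i - m)) / 2 + (w (real i - m + 1) - w (real i - m)) / 2"
        unfolding left[symmetric] right[symmetric] by (simp add: e_eq)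
      also have "\<dots> = \<mu> * w (real i - m)"
        using rec[of "real i - m"] by (simp add: field_simps)
      finally show ?thesis unfolding row by (simp add: e_eq x_path)
    next
      fix c j assume c: "c \<in> {0, l}" and j: "j < s" and e_eq: "e = {Path c, Leaf c j}"
      have "(\<Sum>z\<in>e. (S z - 2 * x e) / real (degree E z)) = (w m + real s * a - 2 * a) / (real s + 1) - a"
        using c j by (simp add: e_eq x_leaf S_center S_leaf deg_center deg_leaf add.commute)
      also have "\<dots> = \<mu> * a"
        unfolding wm d_def by (simp add: field_simps)
      finally show ?thesis unfolding row by (simp add: e_eq x_leaf)
    qed
  qed
  have "{Path 0, Path (Suc 0)} \<in> E"
    using l by (auto simp: E_def double_star_subdiv_def)
  then show ?thesis
    unfolding E_def[symmetric]
    using finite_double_star_subdiv x_pos eig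
    by (intro lambda_max_eqI[where v = x]) (auto simp: E_def ricci_matrix_def intro!: sum_nonneg)
qed

section \<open>Nonnegative roots and cosh eigenvectors\<close>

text \<open>The absolute value matters for \<open>l = 2\<close>, where \<open>(l - 3) / 2\<close> is
  negative.\<close>

lemma abs_half_diff_le:
  assumes "l \<ge> (2::nat)"
  shows "\<bar>(real l - 3) / 2\<bar> \<le> (real l - 1) / 2"
  using assms by (auto simp: abs_le_iff field_simps)

text \<open>The cosh is even and positive, and its addition theorem is the recurrence. Since the
  largest eigenvalue is one number, this also yields uniqueness of nonnegative roots.\<close>

lemma lambda_max_eq_nonneg_root:
  assumes "l \<ge> 2" "\<mu> \<ge> 0" "R_fun l \<mu> = complex_of_real (beta_fun s \<mu>)"
  shows "lambda_max (double_star_subdiv s l) (ricci_matrix (double_star_subdiv s l)) = \<mu>"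
proof (rule lambda_max_double_star_subdivI[where w = "\<lambda>x. cosh (x * arcosh (1 + \<mu>))"])
  have "cosh (arcosh (1 + \<mu>)) = 1 + \<mu>" using assms(2) by simp
  then show "cosh ((x - 1) * arcosh (1 + \<mu>)) + cosh ((x + 1) * arcosh (1 + \<mu>)) =
      2 * (1 + \<mu>) * cosh (x * arcosh (1 + \<mu>))" for x
    by (simp add: left_diff_distrib distrib_right cosh_add cosh_diff)
  have "beta_fun s \<mu> = cosh ((real l - 3) / 2 * arcosh (1 + \<mu>)) / cosh ((real l - 1) / 2 * arcosh (1 + \<mu>))"
    using R_fun_nonneg[OF assms(2), of l] assms(3) by (metis of_real_eq_iff)
  then show "cosh ((real l - 3) / 2 * arcosh (1 + \<mu>)) =
      beta_fun s \<mu> * cosh ((real l - 1) / 2 * arcosh (1 + \<mu>))"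
    by simp
  show "(real s + 1) * \<mu> + 3 > 0" using assms(2) by (simp add: add_nonneg_pos)
qed (use assms in auto)

section \<open>Nonpositive roots and cosine eigenvectors\<close>

text \<open>As \<open>sin \<theta> \<ge> 0\<close>, the principal square root of
  \<open>- (sin \<theta>)\<^sup>2\<close> is \<open>\<i> * sin \<theta>\<close>. The principal
  logarithm of \<open>exp (\<i> * \<theta>)\<close> is then \<open>\<i> * \<theta>\<close>, because
  \<open>\<theta>\<close> lies between 0 and pi.\<close>

lemma arcosh_complex_cos:
  assumes "0 \<le> \<theta>" "\<theta> \<le> pi"
  shows "arcosh (complex_of_real (cos \<theta>)) = \<i> * complex_of_real \<theta>"
proof -
  have "(complex_of_real (cos \<theta>))\<^sup>2 - 1 = (\<i> * complex_of_real (sin \<theta>))\<^sup>2"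
    by (simp add: power_mult_distrib sin_squared_eq flip: of_real_power)
  moreover have "csqrt ((\<i> * complex_of_real (sin \<theta>))\<^sup>2) = \<i> * complex_of_real (sin \<theta>)"
    using sin_ge_zero[OF assms] by (intro csqrt_square) auto
  ultimately have "((complex_of_real (cos \<theta>))\<^sup>2 - 1) powr of_real (1 / 2) = \<i> * complex_of_real (sin \<theta>)"
    by (cases "sin \<theta> = 0") (auto simp: csqrt_conv_powr)
  moreover have "complex_of_real (cos \<theta>) + \<i> * complex_of_real (sin \<theta>) = exp (\<i> * complex_of_real \<theta>)"
    by (simp add: exp_Euler cos_of_real sin_of_real)
  ultimately show ?thesis
    unfolding arcosh_def using assms less_le_trans[of "- pi" 0 \<theta>] by (simp only:) (rule Ln_exp; simp)
qed

lemma cosh_mult_arcosh_complex_cos: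
  assumes "0 \<le> \<theta>" "\<theta> \<le> pi"
  shows "cosh (complex_of_real k * arcosh (complex_of_real (cos \<theta>))) = complex_of_real (cos (k * \<theta>))"
proof -
  have "cosh (complex_of_real k * arcosh (complex_of_real (cos \<theta>))) = cos (complex_of_real (k * \<theta>))"
    unfolding arcosh_complex_cos[OF assms] by (simp add: cosh_conv_cos mult_ac)
  then show ?thesis by (simp only: cos_of_real)
qed

lemma R_fun_cos:
  assumes "0 \<le> \<theta>" "\<theta> \<le> pi"
  shows "R_fun l (cos \<theta> - 1) =
    complex_of_real (cos ((real l - 3) / 2 * \<theta>) / cos ((real l - 1) / 2 * \<theta>))"
  using cosh_mult_arcosh_complex_cos[OF assms, of "(real l - 3) / 2"]
    cosh_mult_arcosh_complex_cos[OF assms, of "(real l - 1) / 2"]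
  by (simp add: R_fun_def)

text \<open>The angle stays below pi / 2 in absolute value, since
  \<open>(l - 1) / 2 * (pi / l) < pi / 2\<close>.\<close>

lemma cos_mult_pos:
  assumes "l \<ge> (2::nat)" "0 \<le> \<theta>" "\<theta> \<le> pi / real l" "\<bar>x\<bar> \<le> (real l - 1) / 2"
  shows "cos (x * \<theta>) > 0"
proof -
  have "\<bar>x * \<theta>\<bar> \<le> (real l - 1) / 2 * (pi / real l)"
    unfolding abs_mult using assms by (intro mult_mono) auto
  also have "\<dots> < pi / 2" using assms(1) by (simp add: field_simps)
  finally show ?thesis by (intro cos_gt_zero_pi) (auto simp: abs_less_iff)
qed

lemma lambda_max_eq_cos_root:
  assumes l: "l \<ge> 2" and \<theta>: "0 \<le> \<theta>" "\<theta> \<le> pi / real l"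
    and D: "(real s + 1) * (cos \<theta> - 1) + 3 > 0"
    and root: "cos ((real l - 3) / 2 * \<theta>) = beta_fun s (cos \<theta> - 1) * cos ((real l - 1) / 2 * \<theta>)"
  shows "lambda_max (double_star_subdiv s l) (ricci_matrix (double_star_subdiv s l)) = cos \<theta> - 1"
proof (rule lambda_max_double_star_subdivI[where w = "\<lambda>x. cos (x * \<theta>)"])
  show "cos ((x - 1) * \<theta>) + cos ((x + 1) * \<theta>) = 2 * (1 + (cos \<theta> - 1)) * cos (x * \<theta>)" for x
    by (simp add: left_diff_distrib distrib_right cos_add cos_diff)
  show "cos (x * \<theta>) > 0" if "\<bar>x\<bar> \<le> (real l - 1) / 2" for x
    using cos_mult_pos[OF l \<theta> that] .
qed (use assms in auto)

section \<open>Existence of roots\<close>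

text \<open>This form shows the threshold \<open>s = 3\<close>: the difference to 1, which is the
  value of \<open>R_fun l\<close> at 0, has the sign of \<open>3 - s\<close>.\<close>

lemma beta_fun_0: "beta_fun s 0 = 1 + 2 * (3 - real s) / (3 * (real s + 1))"
proof -
  have "2 / n - 2 * real s / (n * 3) = 2 * (3 - real s) / (3 * n)" if "n > 0" for n
    using that by (simp add: field_simps)
  from this[of "real s + 1"] show ?thesis by (simp add: beta_fun_def)
qed

text \<open>The intermediate value theorem is applied in \<open>t\<close> with
  \<open>\<mu> = cosh t - 1\<close>, and the denominator of \<open>R_fun\<close> is cleared. At
  \<open>\<mu> = 0\<close> the bound \<open>s \<ge> 3\<close> gives
  \<open>beta_fun s 0 \<le> 1\<close>; at \<open>\<mu> = 1\<close>, that is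
  \<open>t = arcosh 2\<close>, \<open>beta_fun\<close> is at least 1 and the cosh quotient at most
  1.\<close>

lemma ex_nonneg_root:
  assumes l: "l \<ge> 2" and s: "s \<ge> 3"
  shows "\<exists>\<mu>\<ge>0. R_fun l \<mu> = complex_of_real (beta_fun s \<mu>)"
proof -
  define g where "g t = beta_fun s (cosh t - 1) * cosh ((real l - 1) / 2 * t) - cosh ((real l - 3) / 2 * t)" for t
  have D: "(real s + 1) * (cosh t - 1) + 3 > 0" for t
    using cosh_real_ge_1[of t] by (intro add_nonneg_pos) auto
  have "isCont g t" for t
    unfolding g_def beta_fun_def using D[of t] by (intro continuous_intros) auto
  moreover have "g 0 \<le> 0"
    using s by (simp add: g_def beta_fun_0 divide_nonpos_pos)
  moreover have "g (arcosh 2) \<ge> 0"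
  proof -
    let ?T = "arcosh (2::real)"
    have "cosh ((real l - 3) / 2 * ?T) = cosh (\<bar>(real l - 3) / 2\<bar> * ?T)"
      by (simp add: abs_if)
    also have "\<dots> \<le> cosh ((real l - 1) / 2 * ?T)"
      using abs_half_diff_le[OF l] by (intro cosh_real_nonneg_le_iff[THEN iffD2] mult_right_mono) auto
    finally have le: "cosh ((real l - 3) / 2 * ?T) \<le> cosh ((real l - 1) / 2 * ?T)" .
    have "2 * real s / ((real s + 1) * (real s + 1 + 3)) \<le> 1"
      by (subst divide_le_eq_1_pos) (simp_all add: algebra_simps add_pos_nonneg)
    moreover have "2 / (real s + 1) \<ge> 0" by simp
    ultimately have "beta_fun s 1 \<ge> 1"
      unfolding beta_fun_def mult_1_right by linarith
    then have "1 * cosh ((real l - 1) / 2 * ?T) \<le> beta_fun s 1 * cosh ((real l - 1) / 2 * ?T)"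
      by (intro mult_right_mono) auto
    moreover have "cosh ?T - 1 = 1" by simp
    ultimately show ?thesis unfolding g_def using le by (simp only:)
  qed
  ultimately obtain t where t: "t \<ge> 0" "g t = 0"
    using IVT[of g 0 0 "arcosh 2"] by auto
  have "cosh ((real l - 3) / 2 * t) / cosh ((real l - 1) / 2 * t) = beta_fun s (cosh t - 1)"
    using t(2) by (simp add: g_def divide_eq_eq)
  then have "R_fun l (cosh t - 1) = complex_of_real (beta_fun s (cosh t - 1))"
    using R_fun_nonneg[of "cosh t - 1" l] t(1) by (simp add: arcosh_cosh_real cosh_real_ge_1)
  then show ?thesis using cosh_real_ge_1[of t] by (intro exI[of _ "cosh t - 1"]) auto
qed

text \<open>At \<theta> = pi / l the eigenvector is that of the bare path (s = 0); there the equation, cleared of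
  its denominators, has the sign opposite to the one at 0.\<close>

lemma ex_cos_root:
  assumes l: "l \<ge> 2" and s: "s < 3"
  shows "\<exists>\<theta>. 0 \<le> \<theta> \<and> \<theta> \<le> pi / real l \<and> (real s + 1) * (cos \<theta> - 1) + 3 > 0 \<and>
    cos ((real l - 3) / 2 * \<theta>) = beta_fun s (cos \<theta> - 1) * cos ((real l - 1) / 2 * \<theta>)"
proof -
  define d where "d \<theta> = (real s + 1) * (cos \<theta> - 1) + 3" for \<theta>
  define u where "u \<theta> = cos ((real l - 1) / 2 * \<theta>)" for \<theta>
  define q where "q \<theta> = cos ((real l - 3) / 2 * \<theta>) - (2 * (cos \<theta> - 1) + 1 + 2 / (real s + 1)) * u \<theta>" for \<theta>
  \<comment> \<open>This is \<open>d \<theta>\<close> times the difference of the two sides of the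
    cosine equation. Clearing \<open>d\<close> keeps \<open>g\<close> continuous where
    \<open>d\<close> vanishes, as it does for \<open>s = 2\<close>, \<open>l = 2\<close> at
    \<open>\<theta> = pi / 2\<close>.\<close>
  define g where "g \<theta> = d \<theta> * q \<theta> + 2 * real s / (real s + 1) * u \<theta>" for \<theta>
  have u_pos: "u \<theta> > 0" if "0 \<le> \<theta>" "\<theta> \<le> pi / real l" for \<theta>
    unfolding u_def using cos_mult_pos[OF l that, of "(real l - 1) / 2"] l by simp
  have d_nonneg: "d \<theta> \<ge> 0" if "0 \<le> \<theta>" "\<theta> \<le> pi / real l" for \<theta>
  proof -
    have "pi / real l \<le> pi / 2" using l by (intro divide_left_mono) auto
    then have "cos \<theta> \<ge> 0" using that by (intro cos_ge_zero) linarith+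
    \<comment> \<open>Hence \<open>d \<theta> \<ge> 2 - s\<close>, which is nonnegative for
      \<open>s < 3\<close>.\<close>
    then have "(real s + 1) * (cos \<theta> - 1) \<ge> (real s + 1) * (- 1)"
      by (intro mult_left_mono) auto
    then show ?thesis using s by (simp add: d_def)
  qed
  have "isCont g \<theta>" for \<theta>
    unfolding g_def d_def q_def u_def by (intro continuous_intros) auto
  moreover have "g 0 \<le> 0"
  proof -
    have "g 0 = (2 * real s - 6) / (real s + 1)"
      by (simp add: g_def d_def q_def u_def diff_divide_distrib)
    then show ?thesis using s by (simp add: divide_nonpos_pos)
  qed
  moreover have "g (pi / real l) \<ge> 0"
  proof -
    let ?\<theta> = "pi / real l"
    have "cos ((real l - 3) / 2 * ?\<theta>) + cos ((real l + 1) / 2 * ?\<theta>) = 2 * cos ?\<theta> * u ?\<theta>"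
    proof -
      have "(real l - 3) / 2 * \<phi> = (real l - 1) / 2 * \<phi> - \<phi>"
        and "(real l + 1) / 2 * \<phi> = (real l - 1) / 2 * \<phi> + \<phi>" for \<phi>
        by (simp_all add: field_simps)
      then show ?thesis by (simp only: cos_add cos_diff u_def) simp
    qed
    \<comment> \<open>The offsets \<open>(l - 1) / 2\<close> and \<open>(l + 1) / 2\<close> add up
      to \<open>l\<close>, so at \<open>pi / l\<close> the two angles are supplementary.\<close>
    moreover have "cos ((real l + 1) / 2 * ?\<theta>) = - u ?\<theta>"
    proof -
      have "(real l + 1) / 2 * ?\<theta> = pi - (real l - 1) / 2 * ?\<theta>"
        using l by (simp add: field_simps)
      then show ?thesis by (simp only: cos_pi_minus u_def)
    qed
    ultimately have "q ?\<theta> = (2 - 2 / (real s + 1)) * u ?\<theta>"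
      by (simp add: q_def algebra_simps)
    moreover have "2 - 2 / (real s + 1) \<ge> 0" by (simp add: field_simps)
    ultimately show ?thesis
      unfolding g_def using u_pos[of ?\<theta>] d_nonneg[of ?\<theta>]
      by (intro add_nonneg_nonneg mult_nonneg_nonneg) auto
  qed
  ultimately obtain \<theta> where \<theta>: "0 \<le> \<theta>" "\<theta> \<le> pi / real l" "g \<theta> = 0"
    using IVT[of g 0 0 "pi / real l"] by auto
  \<comment> \<open>If \<open>d\<close> vanished at the root, the remaining term of \<open>g\<close>
    would force \<open>s = 0\<close>, but then
    \<open>d \<theta> = cos \<theta> + 2 > 0\<close>.\<close>
  have "d \<theta> \<noteq> 0"
  proof
    assume 0: "d \<theta> = 0"
    then have "s = 0" using \<theta> u_pos[of \<theta>] by (simp add: g_def)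
    then have "cos \<theta> = -2" using 0 by (simp add: d_def)
    then show False using cos_ge_minus_one[of \<theta>] by linarith
  qed
  then have d_pos: "d \<theta> > 0" using d_nonneg[OF \<theta>(1,2)] by simp
  have "d \<theta> * q \<theta> = - (2 * real s / (real s + 1) * u \<theta>)"
    using \<theta>(3) by (simp add: g_def eq_neg_iff_add_eq_0)
  then have "q \<theta> = - (2 * real s / (real s + 1) * u \<theta>) / d \<theta>"
    using d_pos by (metis less_irrefl nonzero_mult_div_cancel_left)
  then have "q \<theta> = - (2 * real s / ((real s + 1) * d \<theta>)) * u \<theta>"
    by simp
  then have "cos ((real l - 3) / 2 * \<theta>) = beta_fun s (cos \<theta> - 1) * u \<theta>"
    by (simp add: q_def beta_fun_def d_def algebra_simps)
  then show ?thesis using \<theta> d_pos by (auto simp: d_def u_def)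
qed

section \<open>The equation for the largest eigenvalue and its positive roots\<close>

text \<open>A root found by continuity is identified with \<open>\<mu>\<close> by its positive
  eigenvector: a cosine for \<open>s < 3\<close>, a cosh otherwise. The two inequations ensure that
  the equation does not rest on the convention \<open>x / 0 = 0\<close>.\<close>

lemma lambda_max_double_star_subdiv_root:
  assumes l: "l \<ge> 2"
    and \<mu>: "\<mu> = lambda_max (double_star_subdiv s l) (ricci_matrix (double_star_subdiv s l))"
  shows "(real s + 1) * \<mu> + 3 \<noteq> 0 \<and>
    cosh ((of_nat l - 1) / 2 * arcosh (1 + complex_of_real \<mu>)) \<noteq> 0 \<and>
    R_fun l \<mu> = complex_of_real (beta_fun s \<mu>)"
proof (cases "s < 3")
  case True
  obtain \<theta> where \<theta>: "0 \<le> \<theta>" "\<theta> \<le> pi / real l" "(real s + 1) * (cos \<theta> - 1) + 3 > 0"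
    and root: "cos ((real l - 3) / 2 * \<theta>) = beta_fun s (cos \<theta> - 1) * cos ((real l - 1) / 2 * \<theta>)"
    using ex_cos_root[OF l True] by blast
  have \<mu>_eq: "\<mu> = cos \<theta> - 1" using lambda_max_eq_cos_root[OF l \<theta> root] \<mu> by simp
  have "pi / real l \<le> pi / 1" using l by (intro divide_left_mono) auto
  then have le_pi: "\<theta> \<le> pi" using \<theta>(2) by simp
  have pos: "cos ((real l - 1) / 2 * \<theta>) > 0"
    using cos_mult_pos[OF l \<theta>(1,2), of "(real l - 1) / 2"] l by simp
  have "cosh ((of_nat l - 1) / 2 * arcosh (1 + complex_of_real \<mu>)) = complex_of_real (cos ((real l - 1) / 2 * \<theta>))"
    using cosh_mult_arcosh_complex_cos[OF \<theta>(1) le_pi, of "(real l - 1) / 2"] by (simp add: \<mu>_eq)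
  moreover have "R_fun l \<mu> = complex_of_real (beta_fun s \<mu>)"
    unfolding \<mu>_eq R_fun_cos[OF \<theta>(1) le_pi] using root pos by simp
  ultimately show ?thesis using \<theta>(3) pos by (simp add: \<mu>_eq)
next
  case False
  then obtain \<nu> where "\<nu> \<ge> 0" and root: "R_fun l \<nu> = complex_of_real (beta_fun s \<nu>)"
    using ex_nonneg_root[OF l] by (auto simp: not_less)
  then have "\<mu> = \<nu>" using lambda_max_eq_nonneg_root[OF l] \<mu> by simp
  moreover have "(real s + 1) * \<nu> + 3 > 0" using \<open>\<nu> \<ge> 0\<close> by (simp add: add_nonneg_pos)
  moreover have "cosh ((of_nat l - 1) / 2 * arcosh (1 + complex_of_real \<nu>)) =
      complex_of_real (cosh ((real l - 1) / 2 * arcosh (1 + \<nu>)))"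
    using arcosh_complex_of_real[of "1 + \<nu>"] \<open>\<nu> \<ge> 0\<close> by (simp flip: cosh_complex_of_real)
  ultimately show ?thesis using root by auto
qed

theorem proposition4:
  fixes s l :: nat
  assumes "l \<ge> 2"
  shows "(let \<mu> = lambda_max (double_star_subdiv s l) (ricci_matrix (double_star_subdiv s l))
          in (real s + 1) * \<mu> + 3 \<noteq> 0 \<and>
             cosh ((of_nat l - 1) / 2 * arcosh (1 + complex_of_real \<mu>)) \<noteq> 0 \<and>
             R_fun l \<mu> = complex_of_real (beta_fun s \<mu>))
       \<and> (s > 3 \<longrightarrow> (\<exists>!\<mu>::real. \<mu> > 0 \<and> R_fun l \<mu> = complex_of_real (beta_fun s \<mu>)))
       \<and> (s = 3 \<longrightarrow> R_fun l 0 = complex_of_real (beta_fun s 0) \<and>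
            \<not> (\<exists>\<mu>::real. \<mu> > 0 \<and> R_fun l \<mu> = complex_of_real (beta_fun s \<mu>)))"
proof (intro conjI impI)
  show "let \<mu> = lambda_max (double_star_subdiv s l) (ricci_matrix (double_star_subdiv s l))
      in (real s + 1) * \<mu> + 3 \<noteq> 0 \<and>
         cosh ((of_nat l - 1) / 2 * arcosh (1 + complex_of_real \<mu>)) \<noteq> 0 \<and>
         R_fun l \<mu> = complex_of_real (beta_fun s \<mu>)"
    unfolding Let_def by (rule lambda_max_double_star_subdiv_root[OF assms refl])
  \<comment> \<open>Allowing the root 0 here lets the same fact exclude positive roots for
    \<open>s = 3\<close>.\<close>
  have root_unique: "\<mu> = \<nu>"
    if "\<mu> \<ge> 0" "R_fun l \<mu> = complex_of_real (beta_fun s \<mu>)"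
      and "\<nu> \<ge> 0" "R_fun l \<nu> = complex_of_real (beta_fun s \<nu>)" for \<mu> \<nu>
    using that lambda_max_eq_nonneg_root[OF assms] by metis
  have R_0: "R_fun l 0 = 1"
    by (simp add: R_fun_nonneg)
  show "\<exists>!\<mu>. \<mu> > 0 \<and> R_fun l \<mu> = complex_of_real (beta_fun s \<mu>)" if s: "s > 3"
  proof -
    obtain \<mu> where \<mu>: "\<mu> \<ge> 0" "R_fun l \<mu> = complex_of_real (beta_fun s \<mu>)"
      using ex_nonneg_root[OF assms, of s] s by auto
    \<comment> \<open>The existence result gives only a nonnegative root; comparing both sides at 0
      makes it positive.\<close>
    have "beta_fun s 0 \<noteq> 1"
      using s by (simp add: beta_fun_0)
    then have "\<mu> \<noteq> 0" using \<mu>(2) R_0 by (metis of_real_eq_1_iff)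
    then show ?thesis using \<mu> root_unique by (intro ex1I[of _ \<mu>]) auto
  qed
  assume "s = 3"
  then show zero_root: "R_fun l 0 = complex_of_real (beta_fun s 0)"
    by (simp add: R_0 beta_fun_def)
  show "\<not> (\<exists>\<mu>>0. R_fun l \<mu> = complex_of_real (beta_fun s \<mu>))"
    using root_unique[OF _ _ order_refl zero_root] by (metis less_imp_le less_irrefl)
qed

end
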